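(* Let $a_1,\dots,a_k$ be natural numbers, let $F=F(a_1,\dots,a_k)$ be the free nilspace, and let $M$ be a degree $d$ extension of $F$ by an abelian group $A$ (for some $d\geq 1$). Then $M$ is a split extension, i.e. there is a morphism $m:F\rightarrow M$ with $\pi\circ m=\mathrm{id}_F$, where $\pi:M\rightarrow F$ is the projection.
   Context: A cube morphism $\{0,1\}^n\rightarrow\{0,1\}^m$ is a map extending to an affine homomorphism $\mathbb{Z}^n\rightarrow\mathbb{Z}^m$. A cubespace is a set $X$ with sets $C^n(X)\subseteq X^{\{0,1\}^n}$ closed under precomposition with cube morphisms; a morphism of cubespaces sends cubes to cubes; products carry the coordinatewise cube structure. A nilspace is a cubespace with $C^1(X)=X^{\{0,1\}}$ and the gluing property (a map on $\{0,1\}^n\setminus\{1^n\}$ whose restrictions to all $(n-1)$-faces containing $0^n$ are cubes extends to a cube on $\{0,1\}^n$). For an abelian group $A$, $\mathcal{D}_k(A)$ is $A$ with cubes those $f:\{0,1\}^n\rightarrow A$ with $\sum_{v\in\{0,1\}^{k+1}}(-1)^{v_1+\dots+v_{k+1}}f(\psi(v))=0$ for every cube morphism $\psi:\{0,1\}^{k+1}\rightarrow\{0,1\}^n$. The free nilspace of rank $(a_1,\dots,a_k)$ is $F(a_1,\dots,a_k)=\prod_{i=1}^k\mathcal{D}_i(\mathbb{Z}^{a_i})$. An abelian bundle over $Y$ with structure group $A$ is a set $M$ with a free $A$-action and a surjection $\pi:M\rightarrow Y$ whose fibres are the $A$-orbits; differences $x-y\in A$ are defined within fibres. A degree $d$ extension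 of a nilspace $N$ by $A$ is an abelian bundle $M$ over $N$ with structure group $A$ which is a cubespace such that (1) every $c\in C^n(N)$ equals $\pi\circ c'$ for some $c'\in C^n(M)$; (2) if $c_1\in C^n(M)$ and $\pi\circ c_1=\pi\circ c_2$, then $c_2\in C^n(M)$ iff $c_1-c_2\in C^n(\mathcal{D}_d(A))$. *)

theory Defs
  imports "HOL-Library.FuncSet" "HOL-Library.Function_Algebras"
begin

definition vertices :: "nat \<Rightarrow> bool list set" where
  "vertices n = {v. length v = n}"

definition cube_morphism :: "nat \<Rightarrow> nat \<Rightarrow> (bool list \<Rightarrow> bool list) \<Rightarrow> bool" where
  "cube_morphism m n \<psi> \<longleftrightarrow>
     (\<forall>v\<in>vertices m. \<psi> v \<in> vertices n) \<and>
     (\<exists>(Mt :: nat \<Rightarrow> nat \<Rightarrow> int) (b :: nat \<Rightarrow> int).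
        \<forall>v\<in>vertices m. \<forall>i<n.
          of_bool (\<psi> v ! i) = b i + (\<Sum>j<m. Mt i j * of_bool (v ! j)))"

definition cubespace :: "'x set \<Rightarrow> (nat \<Rightarrow> (bool list \<Rightarrow> 'x) set) \<Rightarrow> bool" where
  "cubespace X C \<longleftrightarrow>
     (\<forall>n. C n \<subseteq> (vertices n \<rightarrow>\<^sub>E X)) \<and>
     (\<forall>m n \<psi> c. cube_morphism m n \<psi> \<longrightarrow> c \<in> C n \<longrightarrow>
        restrict (c \<circ> \<psi>) (vertices m) \<in> C m)"

definition cube_hom ::
  "'x set \<Rightarrow> (nat \<Rightarrow> (bool list \<Rightarrow> 'x) set) \<Rightarrow> 'y set \<Rightarrow> (nat \<Rightarrow> (bool list \<Rightarrow> 'y) set)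
   \<Rightarrow> ('x \<Rightarrow> 'y) \<Rightarrow> bool" where
  "cube_hom X CX Y CY f \<longleftrightarrow>
     (\<forall>x\<in>X. f x \<in> Y) \<and>
     (\<forall>n c. c \<in> CX n \<longrightarrow> restrict (f \<circ> c) (vertices n) \<in> CY n)"

definition ones :: "bool list \<Rightarrow> nat" where
  "ones v = length (filter id v)"

definition D_cond :: "nat \<Rightarrow> nat \<Rightarrow> (bool list \<Rightarrow> 'a::ab_group_add) \<Rightarrow> bool" where
  "D_cond k n f \<longleftrightarrow>
     (\<forall>\<psi>. cube_morphism (Suc k) n \<psi> \<longrightarrow>
        (\<Sum>v\<in>vertices (Suc k). if even (ones v) then f (\<psi> v) else - f (\<psi> v)) = 0)"

definition D_cubes :: "nat \<Rightarrow> nat \<Rightarrow> (bool list \<Rightarrow> 'a::ab_group_add) set" where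
  "D_cubes k n = {f \<in> vertices n \<rightarrow>\<^sub>E (UNIV :: 'a set). D_cond k n f}"

text \<open>Free nilspace F(a_1,...,a_k), a = [a_1,...,a_k].  An element is
  x :: nat => nat => int, where x i (for i < k) is the component in Z^{a_{i+1}},
  i.e. x i j is its j-th coordinate (j < a_{i+1}); all other values are 0.
  The component with index i carries the structure D_{i+1}(Z^{a_{i+1}}).\<close>
definition free_carrier :: "nat list \<Rightarrow> (nat \<Rightarrow> nat \<Rightarrow> int) set" where
  "free_carrier a = {x. \<forall>i j. (i \<ge> length a \<or> j \<ge> a ! i) \<longrightarrow> x i j = 0}"

definition free_cubes :: "nat list \<Rightarrow> nat \<Rightarrow> (bool list \<Rightarrow> (nat \<Rightarrow> nat \<Rightarrow> int)) set" where
  "free_cubes a n = {c \<in> vertices n \<rightarrow>\<^sub>E free_carrier a.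
      \<forall>i < length a. D_cond (Suc i) n (\<lambda>v. c v i)}"

definition bdiff :: "('a \<Rightarrow> 'm \<Rightarrow> 'm) \<Rightarrow> 'm \<Rightarrow> 'm \<Rightarrow> 'a" where
  "bdiff act x y = (THE g. act g y = x)"

definition abelian_bundle ::
  "'m set \<Rightarrow> ('a::ab_group_add \<Rightarrow> 'm \<Rightarrow> 'm) \<Rightarrow> 'y set \<Rightarrow> ('m \<Rightarrow> 'y) \<Rightarrow> bool" where
  "abelian_bundle M act Y p \<longleftrightarrow>
     (\<forall>g x. x \<in> M \<longrightarrow> act g x \<in> M) \<and>
     (\<forall>x\<in>M. act 0 x = x) \<and>
     (\<forall>g h x. x \<in> M \<longrightarrow> act (g + h) x = act g (act h x)) \<and>
     (\<forall>g x. x \<in> M \<longrightarrow> act g x = x \<longrightarrow> g = 0) \<and>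
     p ` M = Y \<and>
     (\<forall>x\<in>M. \<forall>y\<in>M. p x = p y \<longleftrightarrow> (\<exists>g. act g y = x))"

definition degree_extension ::
  "nat \<Rightarrow> 'y set \<Rightarrow> (nat \<Rightarrow> (bool list \<Rightarrow> 'y) set) \<Rightarrow>
   'm set \<Rightarrow> (nat \<Rightarrow> (bool list \<Rightarrow> 'm) set) \<Rightarrow> ('a::ab_group_add \<Rightarrow> 'm \<Rightarrow> 'm) \<Rightarrow> ('m \<Rightarrow> 'y) \<Rightarrow> bool" where
  "degree_extension d N CN M CM act p \<longleftrightarrow>
     abelian_bundle M act N p \<and>
     cubespace M CM \<and>
     (\<forall>n. \<forall>c\<in>CN n. \<exists>c'\<in>CM n. c = restrict (p \<circ> c') (vertices n)) \<and>
     (\<forall>n. \<forall>c1\<in>CM n. \<forall>c2\<in>vertices n \<rightarrow>\<^sub>E M.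
        (\<forall>v\<in>vertices n. p (c1 v) = p (c2 v)) \<longrightarrow>
        (c2 \<in> CM n \<longleftrightarrow>
           restrict (\<lambda>v. bdiff act (c1 v) (c2 v)) (vertices n) \<in> (D_cubes d n :: (bool list \<Rightarrow> 'a) set)))"

end

theory Submission
  imports Defs
begin

text \<open>
  Relative to a set-theoretic section \<open>s\<close> of the projection, the extension is described by
  assigning to each cube \<open>c\<close> of the free nilspace the coset of \<open>C\<^sup>n(\<D>\<^sub>d(A))\<close> of those \<open>g\<close> for which
  \<open>g + s \<circ> c\<close> is a cube; a splitting is a function \<open>f\<close> with \<open>f \<circ> c\<close> in the coset of \<open>c\<close> for all \<open>c\<close>.
  Comparing the cosets of \<open>c\<close> and of its translates by a generator \<open>e\<close> of \<open>\<D>\<^sub>i(\<int>)\<close> along faces of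
  codimension \<open>i\<close> gives a system of the same kind of degree \<open>d - i\<close>, which splits by induction on
  the degree, say by \<open>\<phi>\<close>. Then \<open>(x, t) \<mapsto> (x + e, t + \<phi> x)\<close> is a translation of height \<open>i\<close> of the
  extension. One extends \<open>f\<close> generator by generator so that \<open>f (x + e) = f x + \<phi> x\<close>; since the
  integer cubes of degree \<open>i\<close> are sums of signed indicators of faces of codimension at most \<open>i\<close>,
  any cube is reached from one with vanishing \<open>e\<close>-coordinate by such face translations.
\<close>

definition alt_sum :: "nat \<Rightarrow> (bool list \<Rightarrow> 'a::ab_group_add) \<Rightarrow> 'a" where
  "alt_sum k f = (\<Sum>v\<in>vertices k. if even (ones v) then f v else - f v)"

text \<open>
  Cubes of \<open>\<D>\<^sub>k\<^sub>-\<^sub>1\<close>; shifting the index lets \<open>k = 0\<close>, where only the zero function qualifies, stand for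
  all negative degrees.
\<close>

definition deg_less :: "nat \<Rightarrow> nat \<Rightarrow> (bool list \<Rightarrow> 'a::ab_group_add) \<Rightarrow> bool" where
  "deg_less k n f \<longleftrightarrow> (\<forall>\<psi>. cube_morphism k n \<psi> \<longrightarrow> alt_sum k (\<lambda>v. f (\<psi> v)) = 0)"

lemma D_cond_iff_deg_less: "D_cond k n f \<longleftrightarrow> deg_less (Suc k) n f"
  by (simp add: D_cond_def deg_less_def alt_sum_def)

subsection \<open>Cube morphisms\<close>

text \<open>A 0/1-valued affine function on a cube involves at most one coordinate; \<open>b\<close>
  in the second alternative is a negation flag. This gives a matrix-free description of the
  coordinates of cube morphisms.\<close>

definition literal :: "nat \<Rightarrow> (bool list \<Rightarrow> bool) \<Rightarrow> bool" where
  "literal m \<phi> \<longleftrightarrow> (\<exists>b. \<forall>v\<in>vertices m. \<phi> v = b) \<or>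
     (\<exists>j<m. \<exists>b. \<forall>v\<in>vertices m. \<phi> v = (v ! j \<noteq> b))"

text \<open>The value at the indicator vertex of a set \<open>A\<close> of coordinates is
  \<open>b + sum c A\<close>, so all these sums lie in {0, 1}. A nonzero coefficient is 1 if
  \<open>b = 0\<close> and -1 if \<open>b = 1\<close>, and two of them together would leave {0,
  1}.\<close>

lemma affine_imp_literal:
  fixes c :: "nat \<Rightarrow> int" and b :: int
  assumes aff: "\<And>v. v \<in> vertices m \<Longrightarrow> of_bool (\<phi> v) = b + (\<Sum>j<m. c j * of_bool (v ! j))"
  shows "literal m \<phi>"
proof (cases "\<forall>j<m. c j = 0")
  case True
  then have "of_bool (\<phi> v) = b" if "v \<in> vertices m" for v
    using aff[OF that] by simp
  then have "\<forall>v\<in>vertices m. \<phi> v = (b = 1)" by fastforce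
  then show ?thesis unfolding literal_def by blast
next
  case False
  then obtain j where j: "j < m" "c j \<noteq> 0" by blast
  have val: "b + sum c A \<in> {0, 1}" if "A \<subseteq> {..<m}" for A
  proof -
    let ?v = "map (\<lambda>l. l \<in> A) [0..<m]"
    have "(\<Sum>l<m. c l * of_bool (?v ! l)) = (\<Sum>l<m. if l \<in> A then c l else 0)"
      by (rule sum.cong) auto
    also have "\<dots> = sum c A"
      using that by (simp add: sum.inter_restrict[symmetric] Int_absorb1)
    finally have "of_bool (\<phi> ?v) = b + sum c A"
      using aff[of ?v] by (simp add: vertices_def)
    then show ?thesis by (metis insertCI of_bool_eq_iff of_bool_eq(1) of_bool_eq(2))
  qed
  have b: "b \<in> {0, 1}" using val[of "{}"] by simp
  have bj: "b + c j \<in> {0, 1}" using val[of "{j}"] j by simp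
  have other: "c l = 0" if "l < m" "l \<noteq> j" for l
    using val[of "{l}"] val[of "{j, l}"] b bj j that by auto
  have eq: "of_bool (\<phi> v) = b + c j * of_bool (v ! j)" if "v \<in> vertices m" for v
  proof -
    have "(\<Sum>l<m. c l * of_bool (v ! l)) = (\<Sum>l\<in>{j}. c l * of_bool (v ! l))"
      by (rule sum.mono_neutral_right) (use j other in auto)
    then show ?thesis using aff[OF that] by simp
  qed
  have "\<phi> v = (v ! j \<noteq> (b = 1))" if "v \<in> vertices m" for v
    using eq[OF that] b bj j(2) by (cases "\<phi> v"; cases "v ! j") auto
  then show ?thesis using j(1) unfolding literal_def by blast
qed

lemma literal_imp_affine:
  assumes "literal m \<phi>"
  shows "\<exists>(c :: nat \<Rightarrow> int) b. \<forall>v\<in>vertices m. of_bool (\<phi> v) = b + (\<Sum>j<m. c j * of_bool (v ! j))"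
  using assms unfolding literal_def
proof (elim disjE exE conjE)
  fix b assume "\<forall>v\<in>vertices m. \<phi> v = b"
  then show ?thesis by (intro exI[of _ "\<lambda>_. 0"] exI[of _ "of_bool b"]) simp
next
  fix j b assume j: "j < m" and *: "\<forall>v\<in>vertices m. \<phi> v = (v ! j \<noteq> b)"
  have s: "(\<Sum>l<m. (if l = j then z else 0) * of_bool (v ! l)) = z * of_bool (v ! j)"
    for z :: int and v
    using j by (simp add: if_distrib[of "\<lambda>x. x * _"] cong: if_cong)
  show ?thesis
    by (rule exI[of _ "\<lambda>l. if l = j then (if b then - 1 else 1) else 0"], rule exI[of _ "of_bool b"])
      (use * in \<open>auto simp: s\<close>)
qed

lemma cube_morphism_iff_literal:
  "cube_morphism m n \<psi> \<longleftrightarrow>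
     (\<forall>v\<in>vertices m. \<psi> v \<in> vertices n) \<and> (\<forall>i<n. literal m (\<lambda>v. \<psi> v ! i))"
proof
  assume "cube_morphism m n \<psi>"
  then show "(\<forall>v\<in>vertices m. \<psi> v \<in> vertices n) \<and> (\<forall>i<n. literal m (\<lambda>v. \<psi> v ! i))"
    unfolding cube_morphism_def by (auto intro: affine_imp_literal)
next
  assume *: "(\<forall>v\<in>vertices m. \<psi> v \<in> vertices n) \<and> (\<forall>i<n. literal m (\<lambda>v. \<psi> v ! i))"
  then have "\<forall>i. \<exists>(c :: nat \<Rightarrow> int) b. i < n \<longrightarrow>
      (\<forall>v\<in>vertices m. of_bool (\<psi> v ! i) = b + (\<Sum>j<m. c j * of_bool (v ! j)))"
    using literal_imp_affine by blast
  then obtain Mt :: "nat \<Rightarrow> nat \<Rightarrow> int" and b where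
    "\<forall>i. i < n \<longrightarrow> (\<forall>v\<in>vertices m. of_bool (\<psi> v ! i) = b i + (\<Sum>j<m. Mt i j * of_bool (v ! j)))"
    by metis
  with * show "cube_morphism m n \<psi>" unfolding cube_morphism_def by blast
qed

lemma literal_const: "literal m (\<lambda>v. b)"
  by (auto simp: literal_def)

lemma literal_nth: "j < m \<Longrightarrow> literal m (\<lambda>v. v ! j)"
  unfolding literal_def by (rule disjI2) (rule exI[of _ j], auto)

lemma literal_cong: "(\<And>v. v \<in> vertices m \<Longrightarrow> \<phi> v = \<phi>' v) \<Longrightarrow> literal m \<phi> \<longleftrightarrow> literal m \<phi>'"
  by (simp add: literal_def)

lemma literal_compose:
  assumes "literal n \<phi>" "cube_morphism m n \<psi>"
  shows "literal m (\<lambda>v. \<phi> (\<psi> v))"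
proof -
  have maps: "\<And>v. v \<in> vertices m \<Longrightarrow> \<psi> v \<in> vertices n"
    and lit: "\<And>i. i < n \<Longrightarrow> literal m (\<lambda>v. \<psi> v ! i)"
    using assms(2) by (auto simp: cube_morphism_iff_literal)
  show ?thesis using assms(1) unfolding literal_def[of n]
  proof (elim disjE exE conjE)
    fix b assume "\<forall>v\<in>vertices n. \<phi> v = b"
    then show ?thesis using maps by (auto simp: literal_def)
  next
    fix j b assume j: "j < n" and "\<forall>v\<in>vertices n. \<phi> v = (v ! j \<noteq> b)"
    then have eq: "\<phi> (\<psi> v) = (\<psi> v ! j \<noteq> b)" if "v \<in> vertices m" for v
      using maps that by blast
    from lit[OF j] show ?thesis unfolding literal_def
    proof (elim disjE exE conjE)
      fix b' assume "\<forall>v\<in>vertices m. \<psi> v ! j = b'"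
      then show "(\<exists>b. \<forall>v\<in>vertices m. \<phi> (\<psi> v) = b) \<or> (\<exists>j<m. \<exists>b. \<forall>v\<in>vertices m. \<phi> (\<psi> v) = (v ! j \<noteq> b))"
        using eq by auto
    next
      fix j' b' assume "j' < m" "\<forall>v\<in>vertices m. \<psi> v ! j = (v ! j' \<noteq> b')"
      then have "\<forall>v\<in>vertices m. \<phi> (\<psi> v) = (v ! j' \<noteq> (b' \<noteq> b))" using eq by auto
      with \<open>j' < m\<close>
      show "(\<exists>b. \<forall>v\<in>vertices m. \<phi> (\<psi> v) = b) \<or> (\<exists>j<m. \<exists>b. \<forall>v\<in>vertices m. \<phi> (\<psi> v) = (v ! j \<noteq> b))"
        by blast
    qed
  qed
qed

lemma cube_morphism_vertex: "cube_morphism m n \<psi> \<Longrightarrow> v \<in> vertices m \<Longrightarrow> \<psi> v \<in> vertices n"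
  by (simp add: cube_morphism_def)

lemma cube_morphism_compose:
  assumes "cube_morphism m n \<psi>" "cube_morphism n k \<theta>"
  shows "cube_morphism m k (\<lambda>v. \<theta> (\<psi> v))"
proof -
  have "literal m (\<lambda>v. \<theta> (\<psi> v) ! i)" if "i < k" for i
    using literal_compose[OF _ assms(1), of "\<lambda>v. \<theta> v ! i"] assms(2) that
    by (simp add: cube_morphism_iff_literal)
  then show ?thesis using assms by (simp add: cube_morphism_iff_literal)
qed

lemma cube_morphism_id: "cube_morphism n n (\<lambda>v. v)"
  by (simp add: cube_morphism_iff_literal literal_nth)

lemma cube_morphism_const: "w \<in> vertices n \<Longrightarrow> cube_morphism m n (\<lambda>_. w)"
  by (simp add: cube_morphism_iff_literal literal_const)

lemma cube_morphism_append:
  assumes "cube_morphism m i \<theta>" "cube_morphism m n \<psi>"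
  shows "cube_morphism m (i + n) (\<lambda>v. \<theta> v @ \<psi> v)"
proof -
  have len: "\<And>v. v \<in> vertices m \<Longrightarrow> length (\<theta> v) = i \<and> length (\<psi> v) = n"
    using assms by (auto simp: cube_morphism_def vertices_def)
  have "literal m (\<lambda>v. (\<theta> v @ \<psi> v) ! j)" if "j < i + n" for j
  proof (cases "j < i")
    case True
    then have "literal m (\<lambda>v. (\<theta> v @ \<psi> v) ! j) \<longleftrightarrow> literal m (\<lambda>v. \<theta> v ! j)"
      by (intro literal_cong) (simp add: nth_append len)
    then show ?thesis using assms True by (simp add: cube_morphism_iff_literal)
  next
    case False
    then have "literal m (\<lambda>v. (\<theta> v @ \<psi> v) ! j) \<longleftrightarrow> literal m (\<lambda>v. \<psi> v ! (j - i))"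
      by (intro literal_cong) (simp add: nth_append len)
    then show ?thesis using assms False that by (simp add: cube_morphism_iff_literal)
  qed
  then show ?thesis using len by (simp add: cube_morphism_iff_literal vertices_def)
qed

lemma cube_morphism_take: "cube_morphism (i + n) i (take i)"
  unfolding cube_morphism_iff_literal
  by (auto simp: vertices_def intro: literal_nth)

lemma cube_morphism_drop: "cube_morphism (i + n) n (drop i)"
proof -
  have "literal (i + n) (\<lambda>v. drop i v ! j)" if "j < n" for j
  proof -
    have "literal (i + n) (\<lambda>v. drop i v ! j) \<longleftrightarrow> literal (i + n) (\<lambda>v. v ! (i + j))"
      by (intro literal_cong) (simp add: vertices_def)
    then show ?thesis using that by (simp add: literal_nth)
  qed
  then show ?thesis by (simp add: cube_morphism_iff_literal vertices_def)
qed

lemma cube_morphism_Cons: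
  assumes "literal m \<phi>" "cube_morphism m n \<psi>"
  shows "cube_morphism m (Suc n) (\<lambda>v. \<phi> v # \<psi> v)"
  using cube_morphism_append[of m 1 "\<lambda>v. [\<phi> v]" n \<psi>] assms
  by (simp add: cube_morphism_iff_literal vertices_def)

lemma literal_hd: "literal (Suc n) hd"
proof -
  have "literal (Suc n) hd \<longleftrightarrow> literal (Suc n) (\<lambda>v. v ! 0)"
    by (intro literal_cong hd_conv_nth) (auto simp: vertices_def)
  then show ?thesis by (simp add: literal_nth)
qed

lemma cube_morphism_tl: "cube_morphism (Suc n) n tl"
  using cube_morphism_drop[of 1 n] by (simp add: drop_Suc[abs_def])

lemma cube_morphism_update:
  assumes "j < n" shows "cube_morphism n n (\<lambda>v. v[j := b])"
proof -
  have "literal n (\<lambda>v. v[j := b] ! i)" if "i < n" for i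
  proof (cases "i = j")
    case True
    then have "literal n (\<lambda>v. v[j := b] ! i) \<longleftrightarrow> literal n (\<lambda>_. b)"
      using that by (intro literal_cong) (simp add: vertices_def)
    then show ?thesis by (simp add: literal_const)
  next
    case False
    then show ?thesis using that by (simp add: literal_nth)
  qed
  then show ?thesis by (simp add: cube_morphism_iff_literal vertices_def)
qed

definition ins :: "nat \<Rightarrow> bool \<Rightarrow> bool list \<Rightarrow> bool list" where
  "ins j b u = take j u @ b # drop j u"

lemma cube_morphism_ins:
  assumes "j \<le> k" shows "cube_morphism k (Suc k) (ins j b)"
proof -
  have "cube_morphism (j + (k - j)) (j + Suc (k - j)) (\<lambda>u. take j u @ b # drop j u)"
    by (intro cube_morphism_append cube_morphism_take cube_morphism_Cons literal_const cube_morphism_drop)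
  then show ?thesis using assms by (simp add: ins_def[abs_def])
qed

text \<open>A literal depends on one coordinate \<open>j\<close> at most, hence is constant on each
  of the two facets in that direction. The same \<open>j\<close> serves both facets, so an
  alternating sum can be split along it.\<close>

lemma literal_ins:
  assumes "literal (Suc k) \<phi>"
  shows "\<exists>j\<le>k. \<forall>b. \<exists>e. \<forall>u\<in>vertices k. \<phi> (ins j b u) = e"
proof -
  have mem: "ins j b u \<in> vertices (Suc k)" if "u \<in> vertices k" "j \<le> k" for j b u
    using that by (simp add: ins_def vertices_def)
  show ?thesis using assms unfolding literal_def
  proof (elim disjE exE conjE)
    fix b assume "\<forall>v\<in>vertices (Suc k). \<phi> v = b"
    then have "\<phi> (ins 0 b' u) = b" if "u \<in> vertices k" for b' u
      using mem[OF that, of 0 b'] by simp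
    then show ?thesis by (intro exI[of _ 0]) auto
  next
    fix j b assume j: "j < Suc k" and *: "\<forall>v\<in>vertices (Suc k). \<phi> v = (v ! j \<noteq> b)"
    have "\<phi> (ins j b' u) = (b' \<noteq> b)" if "u \<in> vertices k" for b' u
    proof -
      have "ins j b' u ! j = b'" using j that by (simp add: ins_def vertices_def nth_append)
      then show ?thesis using * mem[OF that, of j b'] j by auto
    qed
    then show ?thesis using j by (intro exI[of _ j]) auto
  qed
qed

subsection \<open>Functions of bounded degree on cubes\<close>

lemma finite_vertices: "finite (vertices n)"
  using finite_lists_length_eq[of "UNIV :: bool set" n] by (simp add: vertices_def)

lemma vertices_0: "vertices 0 = {[]}"
  by (auto simp: vertices_def)

lemma alt_sum_0: "alt_sum 0 f = f []"
  by (simp add: alt_sum_def vertices_0 ones_def)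

lemma alt_sum_cong: "(\<And>v. v \<in> vertices k \<Longrightarrow> f v = g v) \<Longrightarrow> alt_sum k f = alt_sum k g"
  unfolding alt_sum_def by (rule sum.cong) auto

lemma alt_sum_diff: "alt_sum k (\<lambda>v. f v - g v) = alt_sum k f - alt_sum k g"
  unfolding alt_sum_def sum_subtractf[symmetric] by (rule sum.cong) auto

lemma alt_sum_zero: "alt_sum k (\<lambda>v. 0) = 0"
  using alt_sum_diff[of k "\<lambda>v. 0" "\<lambda>v. 0"] by simp

lemma alt_sum_split:
  assumes "j \<le> k"
  shows "alt_sum (Suc k) f = alt_sum k (\<lambda>u. f (ins j False u)) - alt_sum k (\<lambda>u. f (ins j True u))"
proof -
  have inj: "inj_on (ins j b) (vertices k)" for b
  proof (rule inj_onI)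
    fix u u' assume "u \<in> vertices k" "u' \<in> vertices k" and eq: "ins j b u = ins j b u'"
    then have "take j u = take j u' \<and> b # drop j u = b # drop j u'"
      unfolding ins_def by (intro append_eq_append_conv[THEN iffD1]) (auto simp: vertices_def)
    then show "u = u'" by (metis append_take_drop_id list.inject)
  qed
  have nth: "ins j b u ! j = b" if "u \<in> vertices k" for b u
    using that assms by (simp add: ins_def vertices_def nth_append)
  have disj: "ins j False ` vertices k \<inter> ins j True ` vertices k = {}"
    using nth by (metis (no_types, lifting) Int_iff all_not_in_conv imageE)
  have un: "vertices (Suc k) = ins j False ` vertices k \<union> ins j True ` vertices k"
  proof
    show "ins j False ` vertices k \<union> ins j True ` vertices k \<subseteq> vertices (Suc k)"
      using assms by (auto simp: ins_def vertices_def)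
    show "vertices (Suc k) \<subseteq> ins j False ` vertices k \<union> ins j True ` vertices k"
    proof
      fix v assume v: "v \<in> vertices (Suc k)"
      let ?u = "take j v @ drop (Suc j) v"
      have "v = ins j (v ! j) ?u"
        using v assms by (simp add: ins_def vertices_def id_take_nth_drop)
      moreover have "?u \<in> vertices k" using v assms by (simp add: vertices_def)
      ultimately show "v \<in> ins j False ` vertices k \<union> ins j True ` vertices k"
        by (cases "v ! j") auto
    qed
  qed
  have ones: "ones (ins j b u) = of_bool b + ones u" for b u
  proof -
    have "ones u = ones (take j u @ drop j u)" by simp
    then show ?thesis by (simp add: ins_def ones_def del: append_take_drop_id)
  qed
  show ?thesis
    unfolding alt_sum_def un
    by (subst sum.union_disjoint)
      (auto simp: finite_vertices disj sum.reindex[OF inj] ones sum_negf[symmetric]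
        diff_conv_add_uminus simp del: add_uminus_conv_diff intro!: sum.cong)
qed

lemma deg_less_cong:
  assumes "\<And>v. v \<in> vertices n \<Longrightarrow> f v = g v"
  shows "deg_less k n f \<longleftrightarrow> deg_less k n g"
proof -
  have "alt_sum k (\<lambda>v. f (\<psi> v)) = alt_sum k (\<lambda>v. g (\<psi> v))" if "cube_morphism k n \<psi>" for \<psi>
    by (rule alt_sum_cong) (simp add: assms cube_morphism_vertex[OF that])
  then show ?thesis by (simp add: deg_less_def)
qed

lemma deg_less_zero: "deg_less k n (\<lambda>v. 0)"
  by (simp add: deg_less_def alt_sum_zero)

lemma deg_less_diff: "deg_less k n f \<Longrightarrow> deg_less k n g \<Longrightarrow> deg_less k n (\<lambda>v. f v - g v)"
  by (simp add: deg_less_def alt_sum_diff)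

lemma deg_less_uminus: "deg_less k n f \<Longrightarrow> deg_less k n (\<lambda>v. - f v)"
  using deg_less_diff[OF deg_less_zero, of k n f] by simp

lemma deg_less_add: "deg_less k n f \<Longrightarrow> deg_less k n g \<Longrightarrow> deg_less k n (\<lambda>v. f v + g v)"
  using deg_less_diff[OF _ deg_less_uminus, of k n f g] by simp

lemma deg_less_compose:
  assumes "deg_less k n f" "cube_morphism m n \<psi>"
  shows "deg_less k m (\<lambda>v. f (\<psi> v))"
  unfolding deg_less_def
proof (intro allI impI)
  fix \<theta> assume "cube_morphism k m \<theta>"
  from cube_morphism_compose[OF this assms(2)]
  show "alt_sum k (\<lambda>v. f (\<psi> (\<theta> v))) = 0" using assms(1) by (simp add: deg_less_def)
qed

lemma deg_less_0: "deg_less 0 n f \<longleftrightarrow> (\<forall>v\<in>vertices n. f v = 0)"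
  unfolding deg_less_def alt_sum_0
  using cube_morphism_const[of _ n 0] cube_morphism_vertex[of 0 n _ "[]"] by (auto simp: vertices_0)

lemma deg_less_Suc_const: "deg_less (Suc k) n (\<lambda>v. z)"
  by (simp add: deg_less_def alt_sum_split[of 0])

text \<open>A test cube of dimension \<open>k\<close> gains a dimension by using the first
  coordinate as the direction of differentiation; the alternating sum of \<open>f\<close> over it
  is, up to sign, that of the derivative.\<close>

lemma deg_less_Suc_imp_derivative:
  assumes "deg_less (Suc k) (Suc n) f"
  shows "deg_less k n (\<lambda>v. f (True # v) - f (False # v))"
  unfolding deg_less_def
proof (intro allI impI)
  fix \<psi> assume \<psi>: "cube_morphism k n \<psi>"
  have "cube_morphism (Suc k) (Suc n) (\<lambda>u. hd u # \<psi> (tl u))"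
    by (rule cube_morphism_Cons[OF literal_hd cube_morphism_compose[OF cube_morphism_tl \<psi>]])
  then have "alt_sum (Suc k) (\<lambda>u. f (hd u # \<psi> (tl u))) = 0"
    using assms unfolding deg_less_def by blast
  then show "alt_sum k (\<lambda>v. f (True # \<psi> v) - f (False # \<psi> v)) = 0"
    by (simp add: alt_sum_split[of 0] ins_def alt_sum_diff)
qed

text \<open>Multiplication by a literal raises the degree by at most one. Pulled back to a test
  cube, the literal \<open>hd\<close> depends on a single direction \<open>j\<close>; on each facet
  in that direction the product is either 0 or a pullback of \<open>h\<close>.\<close>

lemma deg_less_Suc_if_hd:
  assumes "deg_less k n h"
  shows "deg_less (Suc k) (Suc n) (\<lambda>u. if hd u then h (tl u) else 0)"
  unfolding deg_less_def
proof (intro allI impI)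
  fix \<psi> assume \<psi>: "cube_morphism (Suc k) (Suc n) \<psi>"
  obtain j where j: "j \<le> k" and "\<forall>b. \<exists>e. \<forall>u\<in>vertices k. hd (\<psi> (ins j b u)) = e"
    using literal_ins[OF literal_compose[OF literal_hd \<psi>]] by (elim exE conjE)
  then obtain e where e: "\<And>b u. u \<in> vertices k \<Longrightarrow> hd (\<psi> (ins j b u)) = e b" by metis
  have "alt_sum k (\<lambda>u. if hd (\<psi> (ins j b u)) then h (tl (\<psi> (ins j b u))) else 0) = 0" for b
  proof -
    have "cube_morphism k n (\<lambda>u. tl (\<psi> (ins j b u)))"
      by (rule cube_morphism_compose[OF cube_morphism_compose[OF cube_morphism_ins[OF j] \<psi>] cube_morphism_tl])
    then have "alt_sum k (\<lambda>u. h (tl (\<psi> (ins j b u)))) = 0"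
      using assms unfolding deg_less_def by blast
    moreover have "alt_sum k (\<lambda>u. if hd (\<psi> (ins j b u)) then h (tl (\<psi> (ins j b u))) else 0) =
        alt_sum k (\<lambda>u. if e b then h (tl (\<psi> (ins j b u))) else 0)"
      by (rule alt_sum_cong) (simp add: e)
    ultimately show ?thesis by (cases "e b") (simp_all add: alt_sum_zero)
  qed
  then show "alt_sum (Suc k) (\<lambda>u. if hd (\<psi> u) then h (tl (\<psi> u)) else 0) = 0"
    by (simp add: alt_sum_split[OF j])
qed

text \<open>The forward direction holds because \<open>h\<close> is the derivative of the function
  on the left. Subtraction is truncated: for \<open>k = 0\<close> both sides say that
  \<open>h\<close> vanishes on the vertices.\<close>

lemma deg_less_if_hd:
  "deg_less k (Suc n) (\<lambda>u. if hd u then h (tl u) else 0) \<longleftrightarrow> deg_less (k - 1) n h"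
proof (cases k)
  case 0
  have "h v = 0" if "\<forall>u\<in>vertices (Suc n). (if hd u then h (tl u) else 0) = 0" "v \<in> vertices n" for v
    using that(1)[rule_format, of "True # v"] that(2) by (simp add: vertices_def)
  then show ?thesis using 0 by (auto simp: deg_less_0 vertices_def)
next
  case (Suc k')
  then show ?thesis
    using deg_less_Suc_if_hd[of k' n h]
      deg_less_Suc_imp_derivative[of k' n "\<lambda>u. if hd u then h (tl u) else 0"] by auto
qed

abbreviation all_true :: "bool list \<Rightarrow> bool" where
  "all_true w \<equiv> list_all (\<lambda>b. b) w"

text \<open>The coordinates are peeled off one at a time, each costing one degree. This is the
  source of the drop in degree from a coset system to its derivatives.\<close>

lemma deg_less_if_all_true:
  "deg_less k (i + n) (\<lambda>u. if all_true (take i u) then h (drop i u) else 0) \<longleftrightarrow> deg_less (k - i) n h"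
proof (induction i arbitrary: k)
  case 0
  then show ?case by simp
next
  case (Suc i)
  have "deg_less k (Suc i + n) (\<lambda>u. if all_true (take (Suc i) u) then h (drop (Suc i) u) else 0) \<longleftrightarrow>
      deg_less k (Suc (i + n))
        (\<lambda>u. if hd u then (if all_true (take i (tl u)) then h (drop i (tl u)) else 0) else 0)"
    unfolding add_Suc
  proof (rule deg_less_cong)
    fix v assume "v \<in> vertices (Suc (i + n))"
    then obtain b w where "v = b # w" by (cases v) (auto simp: vertices_def)
    then show "(if all_true (take (Suc i) v) then h (drop (Suc i) v) else 0) =
        (if hd v then if all_true (take i (tl v)) then h (drop i (tl v)) else 0 else 0)" by simp
  qed
  then show ?case by (simp add: deg_less_if_hd[where h = "\<lambda>v. if all_true (take i v) then h (drop i v) else 0"] Suc.IH)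
qed

section \<open>Integer functions of bounded degree as sums of face indicators\<close>

text \<open>A morphism to the \<open>i\<close>-cube followed by \<open>all_true\<close> cuts out a face of codimension at most \<open>i\<close>.\<close>

inductive face_sum :: "nat \<Rightarrow> nat \<Rightarrow> (bool list \<Rightarrow> int) \<Rightarrow> bool" for i n where
  zero: "face_sum i n (\<lambda>_. 0)"
| add: "face_sum i n q \<Longrightarrow> cube_morphism n i \<theta> \<Longrightarrow>
    face_sum i n (\<lambda>v. q v + of_bool (all_true (\<theta> v)))"
| sub: "face_sum i n q \<Longrightarrow> cube_morphism n i \<theta> \<Longrightarrow>
    face_sum i n (\<lambda>v. q v - of_bool (all_true (\<theta> v)))"

lemma face_sum_plus:
  assumes "face_sum i n q'" "face_sum i n q"
  shows "face_sum i n (\<lambda>v. q v + q' v)"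
  using assms
proof (induction rule: face_sum.induct)
  case zero
  then show ?case by simp
next
  case (add q' \<theta>)
  then show ?case using face_sum.add[of i n "\<lambda>v. q v + q' v" \<theta>] by (simp add: algebra_simps)
next
  case (sub q' \<theta>)
  then show ?case using face_sum.sub[of i n "\<lambda>v. q v + q' v" \<theta>] by (simp add: algebra_simps)
qed

lemma face_sum_compose:
  assumes "face_sum i n q" and \<psi>: "cube_morphism m n \<psi>"
  shows "face_sum i m (\<lambda>v. q (\<psi> v))"
  using assms(1)
proof (induction rule: face_sum.induct)
  case zero
  show ?case by (rule face_sum.zero)
next
  case (add q \<theta>)
  show ?case by (rule face_sum.add[OF add.IH cube_morphism_compose[OF \<psi> add.hyps(2)]])
next
  case (sub q \<theta>)
  show ?case by (rule face_sum.sub[OF sub.IH cube_morphism_compose[OF \<psi> sub.hyps(2)]])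
qed

lemma face_sum_if_hd:
  assumes "face_sum i n q"
  shows "face_sum (Suc i) (Suc n) (\<lambda>v. if hd v then q (tl v) else 0)"
  using assms
proof (induction rule: face_sum.induct)
  case zero
  then show ?case using face_sum.zero by simp
next
  case (add q \<theta>)
  have "cube_morphism (Suc n) (Suc i) (\<lambda>v. hd v # \<theta> (tl v))"
    by (rule cube_morphism_Cons[OF literal_hd cube_morphism_compose[OF cube_morphism_tl add.hyps(2)]])
  from face_sum.add[OF add.IH this] show ?case
    by (rule back_subst[of "face_sum _ _"]) auto
next
  case (sub q \<theta>)
  have "cube_morphism (Suc n) (Suc i) (\<lambda>v. hd v # \<theta> (tl v))"
    by (rule cube_morphism_Cons[OF literal_hd cube_morphism_compose[OF cube_morphism_tl sub.hyps(2)]])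
  from face_sum.sub[OF sub.IH this] show ?case
    by (rule back_subst[of "face_sum _ _"]) auto
qed

lemma face_sum_const: "face_sum i n (\<lambda>_. z)"
proof -
  have m: "cube_morphism n i (\<lambda>_. replicate i True)"
    by (rule cube_morphism_const) (simp add: vertices_def)
  have all: "all_true (replicate i True)" by (simp add: list_all_iff)
  show ?thesis
  proof (induction z rule: int_induct[where k = 0])
    case base
    then show ?case by (rule face_sum.zero)
  next
    case (step1 z)
    show ?case using face_sum.add[OF step1.IH m] by (simp add: all)
  next
    case (step2 z)
    show ?case using face_sum.sub[OF step2.IH m] by (simp add: all)
  qed
qed

text \<open>Discrete Taylor expansion in the first coordinate: \<open>q\<close> is its restriction
  to the \<open>False\<close> facet, pulled back along \<open>tl\<close>, plus \<open>hd\<close>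
  times its derivative. The derivative has one degree less, which multiplication by
  \<open>hd\<close> turns into one more codimension.\<close>

lemma deg_less_imp_face_sum:
  assumes "deg_less (Suc i) n q"
  shows "\<exists>q'. face_sum i n q' \<and> (\<forall>v\<in>vertices n. q' v = q v)"
  using assms
proof (induction n arbitrary: i q)
  case 0
  show ?case by (rule exI[of _ "\<lambda>_. q []"]) (simp add: vertices_0 face_sum_const)
next
  case (Suc n)
  have "cube_morphism n (Suc n) (\<lambda>v. False # v)"
    by (intro cube_morphism_Cons literal_const cube_morphism_id)
  then have "deg_less (Suc i) n (\<lambda>v. q (False # v))"
    using Suc.prems deg_less_compose by blast
  then obtain q0 where q0: "face_sum i n q0" "\<And>v. v \<in> vertices n \<Longrightarrow> q0 v = q (False # v)"
    using Suc.IH by blast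
  have d1: "deg_less i n (\<lambda>v. q (True # v) - q (False # v))"
    by (rule deg_less_Suc_imp_derivative[OF Suc.prems])
  have "\<exists>r. face_sum i (Suc n) r \<and>
      (\<forall>b. \<forall>v\<in>vertices n. r (b # v) = (if b then q (True # v) - q (False # v) else 0))"
  proof (cases i)
    case 0
    then have "\<forall>v\<in>vertices n. q (True # v) - q (False # v) = 0"
      using d1 by (simp add: deg_less_0)
    then show ?thesis by (intro exI[of _ "\<lambda>_. 0"]) (simp add: face_sum.zero)
  next
    case (Suc i')
    then obtain q1 where "face_sum i' n q1" "\<forall>v\<in>vertices n. q1 v = q (True # v) - q (False # v)"
      using Suc.IH[of i'] d1 by blast
    then show ?thesis using face_sum_if_hd[of i' n q1] Suc
      by (intro exI[of _ "\<lambda>v. if hd v then q1 (tl v) else 0"]) simp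
  qed
  then obtain r where r: "face_sum i (Suc n) r"
    "\<And>b v. v \<in> vertices n \<Longrightarrow> r (b # v) = (if b then q (True # v) - q (False # v) else 0)" by blast
  have "face_sum i (Suc n) (\<lambda>v. q0 (tl v) + r v)"
    by (rule face_sum_plus[OF r(1) face_sum_compose[OF q0(1) cube_morphism_tl]])
  moreover have "q0 (tl v) + r v = q v" if v: "v \<in> vertices (Suc n)" for v
  proof -
    obtain b w where "v = b # w" "w \<in> vertices n" using v by (cases v) (auto simp: vertices_def)
    then show ?thesis using q0(2) r(2) by (cases b) auto
  qed
  ultimately show ?case by blast
qed

subsection \<open>Cubes of the free nilspace\<close>

text \<open>Evaluation at \<open>j\<close> is additive, so it commutes with alternating sums; this
  reduces the components of the free nilspace to single integer coordinates.\<close>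

lemma deg_less_fun_iff:
  fixes f :: "bool list \<Rightarrow> 'b \<Rightarrow> 'a::ab_group_add"
  shows "deg_less k n f \<longleftrightarrow> (\<forall>j. deg_less k n (\<lambda>v. f v j))"
proof -
  have sum_apply: "sum g A j = (\<Sum>v\<in>A. g v j)" for g :: "bool list \<Rightarrow> 'b \<Rightarrow> 'a" and A j
    by (induction A rule: infinite_finite_induct) auto
  have "alt_sum k g j = alt_sum k (\<lambda>v. g v j)" for g :: "bool list \<Rightarrow> 'b \<Rightarrow> 'a" and j
    unfolding alt_sum_def sum_apply by (rule sum.cong) auto
  then show ?thesis by (auto simp: deg_less_def fun_eq_iff)
qed

definition single :: "nat \<Rightarrow> nat \<Rightarrow> int \<Rightarrow> nat \<Rightarrow> nat \<Rightarrow> int" where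
  "single i j z = (\<lambda>i' j'. if i' = i \<and> j' = j then z else 0)"

lemma single_0: "single i j 0 = 0"
  by (auto simp: single_def fun_eq_iff)

lemma single_add: "single i j (y + z) = single i j y + single i j z"
  by (auto simp: single_def fun_eq_iff)

text \<open>Unlike in \<open>free_cubes\<close>, values off the cube are unconstrained, which spares
  restrictions in composites. Component \<open>i\<close> has degree \<open>i + 1\<close>, and
  \<open>deg_less\<close> takes one more than the degree, hence \<open>Suc (Suc i)\<close>.\<close>

definition free_cube :: "nat list \<Rightarrow> nat \<Rightarrow> (bool list \<Rightarrow> nat \<Rightarrow> nat \<Rightarrow> int) \<Rightarrow> bool" where
  "free_cube a n c \<longleftrightarrow> (\<forall>v\<in>vertices n. c v \<in> free_carrier a) \<and>
     (\<forall>i<length a. \<forall>j. deg_less (Suc (Suc i)) n (\<lambda>v. c v i j))"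

lemma free_cube_cong:
  assumes "\<And>v. v \<in> vertices n \<Longrightarrow> c v = c' v"
  shows "free_cube a n c \<longleftrightarrow> free_cube a n c'"
proof -
  have "deg_less k n (\<lambda>v. c v i j) \<longleftrightarrow> deg_less k n (\<lambda>v. c' v i j)" for k i j
    by (rule deg_less_cong) (simp add: assms)
  then show ?thesis by (simp add: free_cube_def assms)
qed

lemma restrict_mem_free_cubes:
  "restrict c (vertices n) \<in> free_cubes a n \<longleftrightarrow> free_cube a n c"
proof -
  have "deg_less k n (\<lambda>v. restrict c (vertices n) v i) \<longleftrightarrow> deg_less k n (\<lambda>v. c v i)" for k i
    by (rule deg_less_cong) simp
  then show ?thesis
    by (auto simp: free_cubes_def free_cube_def D_cond_iff_deg_less PiE_iff
        deg_less_fun_iff[of _ _ "\<lambda>v. c v _"])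
qed

lemma free_carrier_add: "x \<in> free_carrier a \<Longrightarrow> y \<in> free_carrier a \<Longrightarrow> x + y \<in> free_carrier a"
  by (auto simp: free_carrier_def)

lemma free_carrier_single: "i < length a \<Longrightarrow> j < a ! i \<Longrightarrow> single i j z \<in> free_carrier a"
  by (auto simp: free_carrier_def single_def)

lemma free_cube_add:
  "free_cube a n c \<Longrightarrow> free_cube a n c' \<Longrightarrow> free_cube a n (\<lambda>v. c v + c' v)"
  by (simp add: free_cube_def free_carrier_add deg_less_add)

lemma free_cube_compose:
  assumes "free_cube a n c" and \<psi>: "cube_morphism m n \<psi>"
  shows "free_cube a m (\<lambda>v. c (\<psi> v))"
  using assms(1) deg_less_compose[OF _ \<psi>, of _ "\<lambda>v. c v _ _"]
  by (simp add: free_cube_def cube_morphism_vertex[OF \<psi>])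

lemma free_cube_single:
  assumes "i < length a" "j < a ! i" "deg_less (Suc (Suc i)) n q"
  shows "free_cube a n (\<lambda>v. single i j (q v))"
proof -
  have "deg_less (Suc (Suc i')) n (\<lambda>v. single i j (q v) i' j')" for i' j'
    using assms(3) by (cases "i' = i \<and> j' = j") (auto simp: single_def deg_less_zero)
  then show ?thesis by (simp add: free_cube_def free_carrier_single assms)
qed

text \<open>The case \<open>h = 1\<close> of \<open>deg_less_if_all_true\<close>. Because of it,
  translating by a generator of degree \<open>i\<close> along a face of codimension \<open>i\<close>
  keeps cubes of the free nilspace cubes.\<close>

lemma deg_less_face: "deg_less (Suc i) (i + n) (\<lambda>u. of_bool (all_true (take i u)) :: int)"
  using deg_less_if_all_true[of "Suc i" i n "\<lambda>_. 1 :: int"] by (simp add: of_bool_def deg_less_Suc_const)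

text \<open>On the product of the \<open>(i+1)\<close>-cube (first coordinates) and the \<open>n\<close>-cube. The generator of index
  \<open>i\<close> has height \<open>i + 1\<close>, hence the \<open>Suc i\<close>.\<close>

definition shift ::
  "nat \<Rightarrow> nat \<Rightarrow> (bool list \<Rightarrow> nat \<Rightarrow> nat \<Rightarrow> int) \<Rightarrow> bool list \<Rightarrow> nat \<Rightarrow> nat \<Rightarrow> int" where
  "shift i j c u = c (drop (Suc i) u) + single i j (of_bool (all_true (take (Suc i) u)))"

lemma free_cube_shift:
  assumes "free_cube a n c" "i < length a" "j < a ! i"
  shows "free_cube a (Suc i + n) (shift i j c)"
  unfolding shift_def
  by (rule free_cube_add[OF free_cube_compose[OF assms(1) cube_morphism_drop]
        free_cube_single[OF assms(2,3) deg_less_face]])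

subsection \<open>Coset systems\<close>

text \<open>\<open>K n c\<close> is the coset attached to the cube \<open>c\<close>, and
  \<open>k\<close> is one more than its degree. As functions are total, \<open>cong_base\<close>
  discards the values of \<open>c\<close> off the cube; for \<open>g\<close> the same follows from
  \<open>coset\<close>.\<close>

locale coset_system =
  fixes a :: "nat list" and k :: nat
    and K :: "nat \<Rightarrow> (bool list \<Rightarrow> nat \<Rightarrow> nat \<Rightarrow> int) \<Rightarrow> (bool list \<Rightarrow> 'a::ab_group_add) \<Rightarrow> bool"
  assumes ex: "free_cube a n c \<Longrightarrow> \<exists>g. K n c g"
    and coset: "free_cube a n c \<Longrightarrow> K n c g \<Longrightarrow> K n c g' \<longleftrightarrow> deg_less k n (\<lambda>v. g' v - g v)"
    and compose: "free_cube a n c \<Longrightarrow> K n c g \<Longrightarrow> cube_morphism m n \<psi> \<Longrightarrow>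
      K m (\<lambda>v. c (\<psi> v)) (\<lambda>v. g (\<psi> v))"
    and cong_base: "K n c g \<Longrightarrow> (\<And>v. v \<in> vertices n \<Longrightarrow> c v = c' v) \<Longrightarrow> K n c' g"
begin

lemma cong:
  assumes "free_cube a n c" "K n c g"
    and "\<And>v. v \<in> vertices n \<Longrightarrow> c v = c' v" "\<And>v. v \<in> vertices n \<Longrightarrow> g v = g' v"
  shows "K n c' g'"
proof -
  have "deg_less k n (\<lambda>v. g' v - g v) \<longleftrightarrow> deg_less k n (\<lambda>v. 0 :: 'a)"
    by (rule deg_less_cong) (simp add: assms(4))
  then have "K n c g'" using coset[OF assms(1,2)] by (simp add: deg_less_zero)
  then show ?thesis using assms(3) by (rule cong_base)
qed

text \<open>On the product cube, \<open>shift i j c\<close> is \<open>c\<close> on every slice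
  except the one whose first coordinates are all True, where the generator is added. So
  \<open>h\<close> is the jump of a coset member that restricts to \<open>g\<close> on all other
  slices.\<close>

definition derivative ::
  "nat \<Rightarrow> nat \<Rightarrow> nat \<Rightarrow> (bool list \<Rightarrow> nat \<Rightarrow> nat \<Rightarrow> int) \<Rightarrow> (bool list \<Rightarrow> 'a) \<Rightarrow> bool" where
  "derivative i j n c h \<longleftrightarrow> (\<exists>g. K n c g \<and> K (Suc i + n) (shift i j c)
     (\<lambda>u. g (drop (Suc i) u) + (if all_true (take (Suc i) u) then h (drop (Suc i) u) else 0)))"

text \<open>
  A function in the coset of the shifted cube is corrected one coordinate \<open>l\<close> at a time until it
  agrees with \<open>g\<close> wherever some new coordinate is 0: on the face \<open>l = 0\<close> the shifted cube is
  unshifted, so the error there is of bounded degree and may be subtracted everywhere.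
\<close>

lemma derivative_ex:
  assumes c: "free_cube a n c" and gen: "i < length a" "j < a ! i"
  shows "\<exists>h. derivative i j n c h"
proof -
  let ?N = "Suc i + n"
  note sh = free_cube_shift[OF c gen]
  obtain g where g: "K n c g" using ex[OF c] by blast
  have "\<exists>G. K ?N (shift i j c) G \<and>
      (\<forall>u\<in>vertices ?N. (\<exists>m<l. \<not> u ! m) \<longrightarrow> G u = g (drop (Suc i) u))" if "l \<le> Suc i" for l
    using that
  proof (induction l)
    case 0
    then show ?case using ex[OF sh] by simp
  next
    case (Suc l)
    then obtain G where G: "K ?N (shift i j c) G"
      and Gg: "\<And>u m. u \<in> vertices ?N \<Longrightarrow> m < l \<Longrightarrow> \<not> u ! m \<Longrightarrow> G u = g (drop (Suc i) u)"
      by auto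
    let ?\<psi> = "\<lambda>u :: bool list. u[l := False]"
    have \<psi>: "cube_morphism ?N ?N ?\<psi>" by (rule cube_morphism_update) (use Suc.prems in simp)
    have drop: "drop (Suc i) (?\<psi> u) = drop (Suc i) u" for u using Suc.prems by simp
    have face: "shift i j c (?\<psi> u) = c (drop (Suc i) u)" if "u \<in> vertices ?N" for u
    proof -
      have "take (Suc i) (?\<psi> u) ! l = False" "l < length (take (Suc i) (?\<psi> u))"
        using that Suc.prems by (auto simp: vertices_def)
      then have "\<not> all_true (take (Suc i) (?\<psi> u))" by (metis list_all_length)
      then show ?thesis by (simp add: shift_def drop single_0)
    qed
    have "K ?N (\<lambda>u. c (drop (Suc i) u)) (\<lambda>u. G (?\<psi> u))"
      by (rule cong_base[OF compose[OF sh G \<psi>]]) (rule face)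
    from coset[OF free_cube_compose[OF c cube_morphism_drop] this, THEN iffD1,
        OF compose[OF c g cube_morphism_drop]]
    have d: "deg_less k ?N (\<lambda>u. g (drop (Suc i) u) - G (?\<psi> u))" .
    let ?G = "\<lambda>u. G u + (g (drop (Suc i) u) - G (?\<psi> u))"
    have "K ?N (shift i j c) ?G"
      using coset[OF sh G, of ?G] d by simp
    moreover have "?G u = g (drop (Suc i) u)" if u: "u \<in> vertices ?N" and m: "m < Suc l" "\<not> u ! m" for u m
    proof (cases "m = l")
      case True
      then have "u ! l = False" using m by simp
      then have "?\<psi> u = u" by (metis list_update_id)
      then show ?thesis by simp
    next
      \<comment> \<open>Here \<open>G\<close> already equals the pullback of \<open>g\<close> at
        both \<open>u\<close> and \<open>?\<psi> u\<close>, so the correction vanishes and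
        coordinates treated earlier are not disturbed.\<close>
      case False
      then have "m < l" using m by simp
      moreover from this have "\<not> ?\<psi> u ! m" using m by simp
      ultimately show ?thesis
        using Gg[OF u] Gg[OF cube_morphism_vertex[OF \<psi> u]] m(2) by (simp add: drop)
    qed
    ultimately show ?case by blast
  qed
  from this[of "Suc i"] obtain G where G: "K ?N (shift i j c) G"
    and Gg: "\<And>u m. u \<in> vertices ?N \<Longrightarrow> m < Suc i \<Longrightarrow> \<not> u ! m \<Longrightarrow> G u = g (drop (Suc i) u)"
    by auto
  \<comment> \<open>Only the all-True slice can still differ from the pullback of \<open>g\<close>;
    the jump is read off there.\<close>
  let ?h = "\<lambda>v. G (replicate (Suc i) True @ v) - g v"
  have "G u = g (drop (Suc i) u) + (if all_true (take (Suc i) u) then ?h (drop (Suc i) u) else 0)"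
    if u: "u \<in> vertices ?N" for u
  proof (cases "all_true (take (Suc i) u)")
    case True
    then have "take (Suc i) u = replicate (Suc i) True"
      using u by (intro nth_equalityI) (auto simp: vertices_def list_all_length simp del: replicate_Suc)
    then have "replicate (Suc i) True @ drop (Suc i) u = u"
      by (metis append_take_drop_id)
    then show ?thesis using True by simp
  next
    case False
    then obtain m where "m < Suc i" "\<not> u ! m" using u by (auto simp: vertices_def list_all_length)
    then show ?thesis using Gg[OF u] False by simp
  qed
  then have "K ?N (shift i j c)
      (\<lambda>u. g (drop (Suc i) u) + (if all_true (take (Suc i) u) then ?h (drop (Suc i) u) else 0))"
    by (intro cong[OF sh G]) auto
  then show ?thesis unfolding derivative_def using g by (intro exI[of _ ?h] exI[of _ g] conjI)
qed

text \<open>Two members differ by the pullback of \<open>g' - g\<close>, which has bounded degree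
  and may be dropped, plus \<open>h' - h\<close> supported on a face of codimension
  \<open>i + 1\<close>, where \<open>deg_less_if_all_true\<close> lowers the bound. Conversely, the
  same \<open>g\<close> serves for \<open>h'\<close>.\<close>

lemma derivative_coset:
  assumes c: "free_cube a n c" and gen: "i < length a" "j < a ! i" and "derivative i j n c h"
  shows "derivative i j n c h' \<longleftrightarrow> deg_less (k - Suc i) n (\<lambda>v. h' v - h v)"
proof -
  let ?N = "Suc i + n"
  let ?lift = "\<lambda>g h u. g (drop (Suc i) u) + (if all_true (take (Suc i) u) then h (drop (Suc i) u) else (0::'a))"
  note sh = free_cube_shift[OF c gen]
  obtain g where g: "K n c g" "K ?N (shift i j c) (?lift g h)"
    using assms(4) unfolding derivative_def by blast
  have iff: "deg_less (k - Suc i) n (\<lambda>v. h' v - h v) \<longleftrightarrow>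
      deg_less k ?N (\<lambda>u. if all_true (take (Suc i) u) then h' (drop (Suc i) u) - h (drop (Suc i) u) else 0)"
    by (rule deg_less_if_all_true[symmetric])
  show ?thesis
  proof
    assume "derivative i j n c h'"
    then obtain g' where g': "K n c g'" "K ?N (shift i j c) (?lift g' h')"
      unfolding derivative_def by blast
    have "deg_less k n (\<lambda>v. g' v - g v)" using coset[OF c g(1)] g'(1) by blast
    from deg_less_compose[OF this cube_morphism_drop]
    have "deg_less k ?N (\<lambda>u. g' (drop (Suc i) u) - g (drop (Suc i) u))" .
    moreover have "deg_less k ?N (\<lambda>u. ?lift g' h' u - ?lift g h u)"
      by (rule coset[OF sh g(2), THEN iffD1, OF g'(2)])
    ultimately have "deg_less k ?N (\<lambda>u. (?lift g' h' u - ?lift g h u)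
        - (g' (drop (Suc i) u) - g (drop (Suc i) u)))"
      by (rule deg_less_diff[rotated])
    then show "deg_less (k - Suc i) n (\<lambda>v. h' v - h v)"
      unfolding iff by (rule deg_less_cong[THEN iffD1, rotated]) simp
  next
    assume "deg_less (k - Suc i) n (\<lambda>v. h' v - h v)"
    then have "deg_less k ?N (\<lambda>u. ?lift g h' u - ?lift g h u)"
      unfolding iff by (rule deg_less_cong[THEN iffD1, rotated]) simp
    then have "K ?N (shift i j c) (?lift g h')"
      by (rule coset[OF sh g(2), THEN iffD2])
    then show "derivative i j n c h'" unfolding derivative_def using g(1) by blast
  qed
qed

lemma derivative_coset_system:
  assumes gen: "i < length a" "j < a ! i"
  shows "coset_system a (k - Suc i) (derivative i j)"
proof
  fix n c assume "free_cube a n c"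
  then show "\<exists>h. derivative i j n c h" using gen by (rule derivative_ex)
next
  fix n c h h' assume "free_cube a n c" "derivative i j n c h"
  then show "derivative i j n c h' \<longleftrightarrow> deg_less (k - Suc i) n (\<lambda>v. h' v - h v)"
    using derivative_coset gen by blast
next
  fix n c h m \<psi>
  assume c: "free_cube a n c" and "derivative i j n c h" and \<psi>: "cube_morphism m n \<psi>"
  then obtain g where g: "K n c g" "K (Suc i + n) (shift i j c)
     (\<lambda>u. g (drop (Suc i) u) + (if all_true (take (Suc i) u) then h (drop (Suc i) u) else 0))"
    unfolding derivative_def by blast
  \<comment> \<open>This acts on the last coordinates only, so it preserves the slice carrying the
    generator.\<close>
  let ?\<psi> = "\<lambda>u. take (Suc i) u @ \<psi> (drop (Suc i) u)"
  have \<psi>': "cube_morphism (Suc i + m) (Suc i + n) ?\<psi>"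
    by (rule cube_morphism_append[OF cube_morphism_take cube_morphism_compose[OF cube_morphism_drop \<psi>]])
  have td: "take (Suc i) (?\<psi> u) = take (Suc i) u" "drop (Suc i) (?\<psi> u) = \<psi> (drop (Suc i) u)"
    if "u \<in> vertices (Suc i + m)" for u
    using that by (auto simp: vertices_def)
  have "K (Suc i + m) (shift i j (\<lambda>v. c (\<psi> v)))
     (\<lambda>u. g (\<psi> (drop (Suc i) u)) + (if all_true (take (Suc i) u) then h (\<psi> (drop (Suc i) u)) else 0))"
    by (rule cong[OF free_cube_compose[OF free_cube_shift[OF c gen] \<psi>']
          compose[OF free_cube_shift[OF c gen] g(2) \<psi>']])
      (simp_all only: shift_def td)
  then show "derivative i j m (\<lambda>v. c (\<psi> v)) (\<lambda>v. h (\<psi> v))"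
    unfolding derivative_def using compose[OF c g(1) \<psi>] by (intro exI[of _ "\<lambda>v. g (\<psi> v)"]) simp
next
  fix n c h c'
  assume "derivative i j n c h" and eq: "\<And>v. v \<in> vertices n \<Longrightarrow> c v = c' v"
  then obtain g where g: "K n c g" "K (Suc i + n) (shift i j c)
     (\<lambda>u. g (drop (Suc i) u) + (if all_true (take (Suc i) u) then h (drop (Suc i) u) else 0))"
    unfolding derivative_def by blast
  have "K n c' g" using g(1) eq by (rule cong_base)
  moreover have "K (Suc i + n) (shift i j c')
     (\<lambda>u. g (drop (Suc i) u) + (if all_true (take (Suc i) u) then h (drop (Suc i) u) else 0))"
    by (rule cong_base[OF g(2)]) (simp add: shift_def eq vertices_def)
  ultimately show "derivative i j n c' h" unfolding derivative_def by blast
qed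

text \<open>Pulled back along the graph of \<open>\<theta>\<close>, the product cube becomes
  \<open>c\<close> translated on the face cut out by \<open>\<theta>\<close>. By
  \<open>step\<close>, \<open>f\<close> changes there exactly as a coset member does, so its
  difference from that member is the same for \<open>c\<close> and \<open>c'\<close>.\<close>

lemma face_shift_iff:
  assumes gen: "i < length a" "j < a ! i"
    and der: "\<forall>n c. free_cube a n c \<longrightarrow> derivative i j n c (\<lambda>v. \<phi> (c v))"
    and step: "\<And>x. f (x + single i j 1) = f x + \<phi> x"
    and c: "free_cube a n c" and \<theta>: "cube_morphism n (Suc i) \<theta>"
    and c': "\<And>v. c' v = c v + single i j (of_bool (all_true (\<theta> v)))"
  shows "free_cube a n c'" "K n c (\<lambda>v. f (c v)) \<longleftrightarrow> K n c' (\<lambda>v. f (c' v))"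
proof -
  obtain g where g: "K n c g" "K (Suc i + n) (shift i j c)
     (\<lambda>u. g (drop (Suc i) u) + (if all_true (take (Suc i) u) then \<phi> (c (drop (Suc i) u)) else 0))"
    using der c unfolding derivative_def by blast
  let ?\<theta> = "\<lambda>v. \<theta> v @ v"
  have \<theta>': "cube_morphism n (Suc i + n) ?\<theta>"
    by (rule cube_morphism_append[OF \<theta> cube_morphism_id])
  have td: "take (Suc i) (?\<theta> v) = \<theta> v" "drop (Suc i) (?\<theta> v) = v" if "v \<in> vertices n" for v
    using cube_morphism_vertex[OF \<theta> that] by (auto simp: vertices_def)
  note sh = free_cube_shift[OF c gen]
  have eq: "shift i j c (?\<theta> v) = c' v" if "v \<in> vertices n" for v
    by (simp only: shift_def td[OF that] c')
  have "free_cube a n (\<lambda>v. shift i j c (?\<theta> v)) \<longleftrightarrow> free_cube a n c'"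
    by (rule free_cube_cong) (rule eq)
  then show fc: "free_cube a n c'" using free_cube_compose[OF sh \<theta>'] by simp
  have K': "K n c' (\<lambda>v. g v + (if all_true (\<theta> v) then \<phi> (c v) else 0))"
    by (rule cong[OF free_cube_compose[OF sh \<theta>'] compose[OF sh g(2) \<theta>']])
      (simp_all only: eq td)
  have f: "f (c' v) = f (c v) + (if all_true (\<theta> v) then \<phi> (c v) else 0)" for v
    by (simp add: c' step single_0)
  show "K n c (\<lambda>v. f (c v)) \<longleftrightarrow> K n c' (\<lambda>v. f (c' v))"
    unfolding coset[OF c g(1)] coset[OF fc K'] by (simp add: f)
qed

end

section \<open>Splitting by induction on the generators and on the degree\<close>

lemma int_antiderivative:
  fixes \<psi> :: "int \<Rightarrow> 'a::ab_group_add"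
  shows "\<exists>\<Phi>. \<Phi> 0 = 0 \<and> (\<forall>t. \<Phi> (t + 1) = \<Phi> t + \<psi> t)"
proof -
  \<comment> \<open>For negative \<open>t\<close> this is minus the sum of \<open>\<psi>\<close>
    over \<open>t, ..., -1\<close>, so the recurrence also holds below 0.\<close>
  define \<Phi> where "\<Phi> t = (if 0 \<le> t then \<Sum>s<nat t. \<psi> (int s)
    else - (\<Sum>s<nat (- t). \<psi> (- 1 - int s)))" for t
  have "\<Phi> (t + 1) = \<Phi> t + \<psi> t" for t
  proof (cases "0 \<le> t")
    case True
    then have "nat (t + 1) = Suc (nat t)" by simp
    then show ?thesis using True by (simp add: \<Phi>_def)
  next
    case False
    then have "nat (- t) = Suc (nat (- (t + 1)))" "- 1 - int (nat (- (t + 1))) = t" by auto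
    then show ?thesis using False by (cases "t = - 1") (auto simp: \<Phi>_def)
  qed
  then show ?thesis by (intro exI[of _ \<Phi>]) (simp add: \<Phi>_def)
qed

text \<open>Induction on the set \<open>S\<close> of coordinates allowed to be nonzero. When a
  generator joins, the old \<open>f\<close> is kept where the new coordinate is 0 and continued
  along lines in the new direction with increments \<open>\<phi>\<close>.\<close>

lemma (in coset_system) split_of_derivatives:
  assumes der: "\<And>i j. i < length a \<Longrightarrow> j < a ! i \<Longrightarrow>
      \<exists>\<phi>. \<forall>n c. free_cube a n c \<longrightarrow> derivative i j n c (\<lambda>v. \<phi> (c v))"
    and S: "finite S" "S \<subseteq> (SIGMA i:{..<length a}. {..<a ! i})"
  shows "\<exists>f. \<forall>n c. free_cube a n c \<longrightarrow>
    (\<forall>v\<in>vertices n. \<forall>i j. (i, j) \<notin> S \<longrightarrow> c v i j = 0) \<longrightarrow> K n c (\<lambda>v. f (c v))"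
  using S
proof (induction S rule: finite_induct)
  case empty
  \<comment> \<open>With every coordinate forced to 0, each cube is a pullback of the single
    0-dimensional cube, so a constant \<open>f\<close> suffices.\<close>
  have z: "free_cube a 0 (\<lambda>_. 0)"
    by (simp add: free_cube_def free_carrier_def deg_less_zero)
  then obtain g where g: "K 0 (\<lambda>_. 0) g" using ex by blast
  have "K n c (\<lambda>v. g [])" if c: "\<forall>v\<in>vertices n. \<forall>i j. c v i j = 0" for n c
  proof -
    have "cube_morphism n 0 (\<lambda>_. [])" by (rule cube_morphism_const) (simp add: vertices_0)
    from compose[OF z g this] show ?thesis
      by (rule cong_base) (use c in \<open>simp add: fun_eq_iff\<close>)
  qed
  then show ?case by (intro exI[of _ "\<lambda>_. g []"]) simp
next
  case (insert e S)
  obtain i j where e: "e = (i, j)" by (cases e)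
  then have gen: "i < length a" "j < a ! i" using insert.prems by auto
  obtain f where f: "\<And>n c. free_cube a n c \<Longrightarrow>
      (\<forall>v\<in>vertices n. \<forall>i j. (i, j) \<notin> S \<longrightarrow> c v i j = 0) \<Longrightarrow> K n c (\<lambda>v. f (c v))"
    using insert by auto
  obtain \<phi> where \<phi>: "\<forall>n c. free_cube a n c \<longrightarrow> derivative i j n c (\<lambda>v. \<phi> (c v))"
    using der[OF gen] by blast
  have "\<forall>y. \<exists>\<Phi>. \<Phi> 0 = 0 \<and> (\<forall>t. \<Phi> (t + 1) = \<Phi> t + \<phi> (y + single i j t))"
    by (intro allI int_antiderivative)
  then obtain \<Phi> where \<Phi>0: "\<And>y. \<Phi> y 0 = 0"
    and \<Phi>: "\<And>y t. \<Phi> y (t + 1) = \<Phi> y t + \<phi> (y + single i j t)" by metis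
  define cut where "cut x = x + single i j (- x i j)" for x
  \<comment> \<open>The second term sums \<open>\<phi>\<close> along the line from
    \<open>cut x\<close> to \<open>x\<close>; it is 0 where the new coordinate vanishes, so
    \<open>f'\<close> agrees with \<open>f\<close> there.\<close>
  define f' where "f' x = f (cut x) + \<Phi> (cut x) (x i j)" for x
  have f'_step: "f' (x + single i j 1) = f' x + \<phi> x" for x
  proof -
    have 1: "cut (x + single i j 1) = cut x" "cut x + single i j (x i j) = x"
      by (auto simp: cut_def single_def fun_eq_iff)
    have 2: "(x + single i j 1) i j = x i j + 1" by (simp add: single_def)
    show ?thesis unfolding f'_def 1 2 \<Phi> by (simp add: add.assoc)
  qed
  have "K n c (\<lambda>v. f' (c v))"
    if c: "free_cube a n c" and supp: "\<forall>v\<in>vertices n. \<forall>i j. (i, j) \<notin> insert e S \<longrightarrow> c v i j = 0" for n c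
  proof -
    let ?c0 = "\<lambda>v. cut (c v)"
    have q: "deg_less (Suc (Suc i)) n (\<lambda>v. c v i j)"
      using c gen by (simp add: free_cube_def)
    have c0: "free_cube a n ?c0"
      unfolding cut_def
      by (rule free_cube_add[OF c free_cube_single[OF gen deg_less_uminus[OF q]]])
    have "K n ?c0 (\<lambda>v. f (?c0 v))"
    proof (rule f[OF c0], intro ballI allI impI)
      fix v i' j' assume "v \<in> vertices n" "(i', j') \<notin> S"
      then show "cut (c v) i' j' = 0"
        using supp by (cases "(i', j') = (i, j)") (auto simp: cut_def single_def e)
    qed
    moreover have "f' (?c0 v) = f (?c0 v)" for v
    proof -
      have "?c0 v i j = 0" by (simp add: cut_def single_def)
      moreover from this have "cut (?c0 v) = ?c0 v" unfolding cut_def[of "?c0 v"] by (simp add: single_0)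
      ultimately show ?thesis by (simp add: f'_def \<Phi>0)
    qed
    ultimately have K0: "K n ?c0 (\<lambda>v. f' (?c0 v))" by simp
    \<comment> \<open>The coordinate removed by \<open>cut\<close> is a signed sum of face
      indicators. They are added back to \<open>?c0\<close> one by one, and
      \<open>face_shift_iff\<close> carries membership along.\<close>
    obtain q' where q': "face_sum (Suc i) n q'" "\<And>v. v \<in> vertices n \<Longrightarrow> q' v = c v i j"
      using deg_less_imp_face_sum[OF q] by blast
    let ?c = "\<lambda>q v. ?c0 v + single i j (q v)"
    from q'(1) have main: "free_cube a n (?c q') \<and> K n (?c q') (\<lambda>v. f' (?c q' v))"
    proof (induction rule: face_sum.induct)
      case zero
      show ?case using c0 K0 by (simp add: single_0)
    next
      case (add q \<theta>)
      have eq: "?c (\<lambda>v. q v + of_bool (all_true (\<theta> v))) v = ?c q v + single i j (of_bool (all_true (\<theta> v)))" for v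
        by (simp add: single_add add.assoc)
      note face = face_shift_iff[where f = f' and c = "?c q" and \<theta> = \<theta>
          and c' = "?c (\<lambda>v. q v + of_bool (all_true (\<theta> v)))",
          OF gen \<phi> f'_step add.IH[THEN conjunct1] add.hyps(2) eq]
      show ?case using face(1) face(2)[THEN iffD1, OF add.IH[THEN conjunct2]] by (rule conjI)
    next
      case (sub q \<theta>)
      \<comment> \<open>A subtraction is an addition read backwards: \<open>?c q\<close> is the face
        translate of \<open>?c ?q\<close>. The equivalence is used from right to left, once
        \<open>?c ?q\<close> is known to be a cube.\<close>
      let ?q = "\<lambda>v. q v - of_bool (all_true (\<theta> v))"
      have eq: "?c q v = ?c ?q v + single i j (of_bool (all_true (\<theta> v)))" for v
        by (simp add: add.assoc flip: single_add)
      have "deg_less (Suc (Suc i)) n (\<lambda>v. of_bool (all_true (take (Suc i) (\<theta> v @ v))) :: int)"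
        by (rule deg_less_compose[OF deg_less_face cube_morphism_append[OF sub.hyps(2) cube_morphism_id]])
      then have d: "deg_less (Suc (Suc i)) n (\<lambda>v. - of_bool (all_true (\<theta> v)) :: int)"
        by (intro deg_less_uminus, elim deg_less_cong[THEN iffD1, rotated])
          (use cube_morphism_vertex[OF sub.hyps(2)] in \<open>simp add: vertices_def\<close>)
      have "free_cube a n (\<lambda>v. ?c q v + single i j (- of_bool (all_true (\<theta> v))))"
        by (rule free_cube_add[OF sub.IH[THEN conjunct1] free_cube_single[OF gen d]])
      moreover have "?c q v + single i j (- of_bool (all_true (\<theta> v))) = ?c ?q v" for v
        by (simp add: add.assoc flip: single_add)
      ultimately have fc: "free_cube a n (?c ?q)" by simp
      note face = face_shift_iff(2)[where f = f' and c = "?c ?q" and \<theta> = \<theta> and c' = "?c q",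
          OF gen \<phi> f'_step fc sub.hyps(2) eq]
      show ?case using fc face[THEN iffD2, OF sub.IH[THEN conjunct2]] by (rule conjI)
    qed
    have "?c q' v = c v" if "v \<in> vertices n" for v
      unfolding q'(2)[OF that] by (auto simp: cut_def single_def fun_eq_iff)
    then show ?thesis
      by (intro cong[of n "?c q'" "\<lambda>v. f' (?c q' v)", OF main[THEN conjunct1] main[THEN conjunct2]])
        simp_all
  qed
  then show ?case by blast
qed

text \<open>Strong induction on \<open>k\<close>: if \<open>k > 0\<close>, the truncated
  \<open>k - Suc i\<close> is smaller, so every derivative splits and \<open>S\<close> may be taken
  to be all generators.\<close>

lemma coset_system_split:
  assumes "coset_system a k K"
  shows "\<exists>f. \<forall>n c. free_cube a n c \<longrightarrow> K n c (\<lambda>v. f (c v))"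
  using assms
proof (induction k arbitrary: K rule: less_induct)
  case (less k)
  interpret coset_system a k K by (rule less.prems)
  show ?case
  proof (cases k)
    case 0
    \<comment> \<open>For \<open>k = 0\<close> the members of a coset agree on the vertices, and
      restriction to a vertex shows that the value there depends only on the point \<open>x\<close>,
      seen as a 0-cube.\<close>
    define f where "f x = (SOME g. K 0 (\<lambda>_. x) g) []" for x
    have "K n c (\<lambda>v. f (c v))" if c: "free_cube a n c" for n c
    proof -
      obtain g where g: "K n c g" using ex[OF c] by blast
      have "f (c v) = g v" if v: "v \<in> vertices n" for v
      proof -
        have m: "cube_morphism 0 n (\<lambda>_. v)" using v by (rule cube_morphism_const)
        have fc: "free_cube a 0 (\<lambda>_. c v)" by (rule free_cube_compose[OF c m])
        have K0: "K 0 (\<lambda>_. c v) (\<lambda>_. g v)" by (rule compose[OF c g m])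
        have "K 0 (\<lambda>_. c v) (SOME g. K 0 (\<lambda>_. c v) g)" using ex[OF fc] by (rule someI_ex)
        then show ?thesis using coset[OF fc K0] by (simp add: 0 deg_less_0 vertices_0 f_def)
      qed
      then show ?thesis by (intro cong[OF c g]) auto
    qed
    then show ?thesis by blast
  next
    case (Suc k')
    have "\<exists>\<phi>. \<forall>n c. free_cube a n c \<longrightarrow> derivative i j n c (\<lambda>v. \<phi> (c v))"
      if "i < length a" "j < a ! i" for i j
      by (rule less.IH[OF _ derivative_coset_system[OF that]]) (simp add: Suc)
    from split_of_derivatives[OF this _ subset_refl]
    obtain f where f: "\<And>n c. free_cube a n c \<Longrightarrow>
        (\<forall>v\<in>vertices n. \<forall>i j. (i, j) \<notin> (SIGMA i:{..<length a}. {..<a ! i}) \<longrightarrow> c v i j = 0) \<Longrightarrow>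
        K n c (\<lambda>v. f (c v))" by auto
    have "K n c (\<lambda>v. f (c v))" if c: "free_cube a n c" for n c
      by (rule f[OF c]) (use c in \<open>auto simp: free_cube_def free_carrier_def\<close>)
    then show ?thesis by blast
  qed
qed

section \<open>Extensions as coset systems\<close>

theorem mainTheorem5:
  fixes a :: "nat list" and d :: nat
    and M :: "'m set" and CM :: "nat \<Rightarrow> (bool list \<Rightarrow> 'm) set"
    and act :: "'a::ab_group_add \<Rightarrow> 'm \<Rightarrow> 'm"
    and p :: "'m \<Rightarrow> (nat \<Rightarrow> nat \<Rightarrow> int)"
  assumes "d \<ge> 1"
    and "degree_extension d (free_carrier a) (free_cubes a) M CM act p"
  shows "\<exists>m. cube_hom (free_carrier a) (free_cubes a) M CM m \<and>
             (\<forall>x\<in>free_carrier a. p (m x) = x)"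
proof -
  let ?F = "free_carrier a"
  have ab: "abelian_bundle M act ?F p" and cs: "cubespace M CM"
    and lift: "\<And>n c. c \<in> free_cubes a n \<Longrightarrow> \<exists>c'\<in>CM n. c = restrict (p \<circ> c') (vertices n)"
    and diff: "\<And>n c1 c2. c1 \<in> CM n \<Longrightarrow> c2 \<in> vertices n \<rightarrow>\<^sub>E M \<Longrightarrow>
      (\<forall>v\<in>vertices n. p (c1 v) = p (c2 v)) \<Longrightarrow>
      c2 \<in> CM n \<longleftrightarrow> restrict (\<lambda>v. bdiff act (c1 v) (c2 v)) (vertices n) \<in> (D_cubes d n :: (bool list \<Rightarrow> 'a) set)"
    using assms(2) unfolding degree_extension_def by blast+
  have act_M: "\<And>g x. x \<in> M \<Longrightarrow> act g x \<in> M"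
    and act_0: "\<And>x. x \<in> M \<Longrightarrow> act 0 x = x"
    and act_add: "\<And>g h x. x \<in> M \<Longrightarrow> act (g + h) x = act g (act h x)"
    and free: "\<And>g x. x \<in> M \<Longrightarrow> act g x = x \<Longrightarrow> g = 0"
    and onto: "p ` M = ?F"
    and fibre: "\<And>x y. x \<in> M \<Longrightarrow> y \<in> M \<Longrightarrow> p x = p y \<longleftrightarrow> (\<exists>g. act g y = x)"
    using ab unfolding abelian_bundle_def by blast+
  have inj: "g = h" if x: "x \<in> M" and eq: "act g x = act h x" for g h x
  proof -
    have "act (- h + g) x = act (- h + h) x" unfolding act_add[OF x] eq ..
    then have "act (- h + g) x = x" by (simp only: ab_left_minus act_0[OF x])
    from free[OF x this] show ?thesis using minus_unique[of "- h" g] by simp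
  qed
  \<comment> \<open>Writing both points as translates of a common base point turns
    \<open>bdiff\<close> into subtraction in the group.\<close>
  have bdiff: "bdiff act (act g x) (act h x) = g - h" if x: "x \<in> M" for g h x
    unfolding bdiff_def
  proof (rule the_equality)
    show "act (g - h) (act h x) = act g x" using act_add[OF x, of "g - h" h] by simp
    fix l assume "act l (act h x) = act g x"
    then have "l + h = g" by (intro inj[OF x]) (simp add: act_add[OF x])
    then show "l = g - h" by (simp add: algebra_simps)
  qed
  \<comment> \<open>A set-theoretic section, chosen with no regard to cubes; the coset system
    measures its failure to be a morphism.\<close>
  define s where "s x = (SOME y. y \<in> M \<and> p y = x)" for x
  have s: "s x \<in> M \<and> p (s x) = x" if "x \<in> ?F" for x
  proof -
    have "\<exists>y. y \<in> M \<and> p y = x" using that unfolding onto[symmetric] by auto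
    then show ?thesis unfolding s_def by (rule someI_ex)
  qed
  have p_act: "p (act g y) = p y" if "y \<in> M" for g y
    using fibre[OF act_M[OF that] that] by auto
  define K where "K n c g \<longleftrightarrow> restrict (\<lambda>v. act (g v) (s (c v))) (vertices n) \<in> CM n"
    for n c and g :: "bool list \<Rightarrow> 'a"
  \<comment> \<open>The parameter is \<open>Suc d\<close> because \<open>deg_less (Suc d)\<close>
    describes cubes of degree \<open>d\<close>.\<close>
  have "coset_system a (Suc d) K"
  proof
    fix n c assume c: "free_cube a n c"
    then have cF: "\<And>v. v \<in> vertices n \<Longrightarrow> c v \<in> ?F" by (simp add: free_cube_def)
    \<comment> \<open>Cube lifting supplies a cube over \<open>c\<close>; transitivity on fibres
      then writes it as a translate of the section.\<close>
    obtain c' where c': "c' \<in> CM n" "restrict c (vertices n) = restrict (p \<circ> c') (vertices n)"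
      using lift c restrict_mem_free_cubes by blast
    have c'_M: "c' \<in> vertices n \<rightarrow>\<^sub>E M" using c'(1) cs unfolding cubespace_def by blast
    have "\<exists>g. act g (s (c v)) = c' v" if v: "v \<in> vertices n" for v
    proof -
      have "p (c' v) = c v" using fun_cong[OF c'(2), of v] v by simp
      then show ?thesis
        using fibre[of "c' v" "s (c v)"] PiE_mem[OF c'_M v] s[OF cF[OF v]] by simp
    qed
    then obtain g where g: "\<And>v. v \<in> vertices n \<Longrightarrow> act (g v) (s (c v)) = c' v" by metis
    have "restrict (\<lambda>v. act (g v) (s (c v))) (vertices n) = c'"
    proof
      fix v show "restrict (\<lambda>v. act (g v) (s (c v))) (vertices n) v = c' v"
        by (cases "v \<in> vertices n") (simp_all add: g PiE_arb[OF c'_M])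
    qed
    then show "\<exists>g. K n c g" unfolding K_def using c'(1) by (intro exI[of _ g]) simp
  next
    fix n c and g g' :: "bool list \<Rightarrow> 'a"
    assume c: "free_cube a n c" and g: "K n c g"
    then have sM: "\<And>v. v \<in> vertices n \<Longrightarrow> s (c v) \<in> M" using s by (simp add: free_cube_def)
    let ?c1 = "restrict (\<lambda>v. act (g v) (s (c v))) (vertices n)"
    let ?c2 = "restrict (\<lambda>v. act (g' v) (s (c v))) (vertices n)"
    have "K n c g' \<longleftrightarrow> restrict (\<lambda>v. bdiff act (?c1 v) (?c2 v)) (vertices n) \<in> (D_cubes d n :: (bool list \<Rightarrow> 'a) set)"
      unfolding K_def by (rule diff[of ?c1 n ?c2]) (use g sM in \<open>auto simp: K_def p_act act_M\<close>)
    also have "\<dots> \<longleftrightarrow> deg_less (Suc d) n (restrict (\<lambda>v. bdiff act (?c1 v) (?c2 v)) (vertices n))"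
      by (simp add: D_cubes_def D_cond_iff_deg_less)
    also have "\<dots> \<longleftrightarrow> deg_less (Suc d) n (\<lambda>v. g v - g' v)"
      by (rule deg_less_cong) (simp add: bdiff sM)
    \<comment> \<open>The extension compares in the order \<open>g - g'\<close>; bounded degree is
      insensitive to sign.\<close>
    also have "\<dots> \<longleftrightarrow> deg_less (Suc d) n (\<lambda>v. g' v - g v)"
      using deg_less_uminus[of "Suc d" n "\<lambda>v. g v - g' v"] deg_less_uminus[of "Suc d" n "\<lambda>v. g' v - g v"]
      by auto
    finally show "K n c g' \<longleftrightarrow> deg_less (Suc d) n (\<lambda>v. g' v - g v)" .
  next
    fix n c and g :: "bool list \<Rightarrow> 'a" and m \<psi>
    assume "K n c g" and \<psi>: "cube_morphism m n \<psi>"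
    then have "restrict (restrict (\<lambda>v. act (g v) (s (c v))) (vertices n) \<circ> \<psi>) (vertices m) \<in> CM m"
      using cs unfolding K_def cubespace_def by blast
    also have "restrict (restrict (\<lambda>v. act (g v) (s (c v))) (vertices n) \<circ> \<psi>) (vertices m) =
        restrict (\<lambda>v. act (g (\<psi> v)) (s (c (\<psi> v)))) (vertices m)"
      by (rule restrict_ext) (simp add: cube_morphism_vertex[OF \<psi>])
    finally show "K m (\<lambda>v. c (\<psi> v)) (\<lambda>v. g (\<psi> v))" unfolding K_def .
  next
    fix n c and g :: "bool list \<Rightarrow> 'a" and c'
    assume "K n c g" and eq: "\<And>v. v \<in> vertices n \<Longrightarrow> c v = c' v"
    moreover have "restrict (\<lambda>v. act (g v) (s (c v))) (vertices n) =
        restrict (\<lambda>v. act (g v) (s (c' v))) (vertices n)"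
      by (rule restrict_ext) (simp add: eq)
    ultimately show "K n c' g" by (simp add: K_def)
  qed
  then obtain f where f: "\<And>n c. free_cube a n c \<Longrightarrow> K n c (\<lambda>v. f (c v))"
    using coset_system_split by blast
  let ?m = "\<lambda>x. act (f x) (s x)"
  have "restrict (?m \<circ> c) (vertices n) \<in> CM n" if c: "c \<in> free_cubes a n" for n c
  proof -
    have "restrict c (vertices n) = c" using c by (auto simp: free_cubes_def PiE_iff extensional_restrict)
    then have "free_cube a n c" using c restrict_mem_free_cubes by metis
    from f[OF this] show ?thesis by (simp add: K_def comp_def)
  qed
  then have "cube_hom ?F (free_cubes a) M CM ?m"
    unfolding cube_hom_def using s act_M by blast
  moreover have "\<forall>x\<in>?F. p (?m x) = x" using s p_act by simp
  ultimately show ?thesis by blast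
qed

end
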